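(* Let $N\ge 3$, let $\dot{\mathbf{Q}}_3\in\mathbb{H}^{I_3\times I_3},\dots,\dot{\mathbf{Q}}_N\in\mathbb{H}^{I_N\times I_N}$ be the invertible quaternion matrices defining the product $\star_{QT}$, and let $\dot{\mathcal{A}}\in\mathbb{H}^{I_1\times I_2\times\cdots\times I_N}$ be a quaternion tensor. Then $\dot{\mathcal{A}}$ can be decomposed as $$\dot{\mathcal{A}}=\dot{\mathcal{U}}\star_{QT}\dot{\mathcal{T}}\star_{QT}\dot{\mathcal{V}}^H,$$ where $\dot{\mathcal{U}}\in\mathbb{H}^{I_1\times I_1\times I_3\times\cdots\times I_N}$ and $\dot{\mathcal{V}}\in\mathbb{H}^{I_2\times I_2\times I_3\times\cdots\times I_N}$ are unitary quaternion tensors and $\dot{\mathcal{T}}\in\mathbb{H}^{I_1\times I_2\times I_3\times\cdots\times I_N}$ is a frontal triangular quaternion tensor, i.e. its frontal slices $\dot{\mathcal{T}}(:,:,i_3,\dots,i_N)$ are triangular quaternion matrices.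
   Context: $\mathbb{H}$ denotes the (non-commutative) real quaternions. The frontal slices of an $N$th-order quaternion tensor $\dot{\mathcal{A}}$ are the matrices $\dot{\mathcal{A}}(:,:,i_3,\dots,i_N)$. The mode-$k$ product $\dot{\mathcal{A}}\times_k\dot{\mathbf{Q}}$ multiplies every mode-$k$ fiber of $\dot{\mathcal{A}}$ on the left by the matrix $\dot{\mathbf{Q}}$. Given the fixed invertible matrices $\dot{\mathbf{Q}}_3,\dots,\dot{\mathbf{Q}}_N$, put $\hat{\dot{\mathcal{A}}}=\dot{\mathcal{A}}\times_3\dot{\mathbf{Q}}_3\times_4\cdots\times_N\dot{\mathbf{Q}}_N$ (products applied from left to right); this transform is a bijection acting on the last $N-2$ modes. Facewise product: $\dot{\mathcal{F}}=\dot{\mathcal{A}}\star_{QF}\dot{\mathcal{B}}$ means $\dot{\mathcal{F}}(:,:,i_3,\dots,i_N)=\dot{\mathcal{A}}(:,:,i_3,\dots,i_N)\,\dot{\mathcal{B}}(:,:,i_3,\dots,i_N)$ for all $i_3,\dots,i_N$. The $\star_{QT}$-product of $\dot{\mathcal{A}}\in\mathbb{H}^{I_1\times l\times I_3\times\cdots\times I_N}$ and $\dot{\mathcal{B}}\in\mathbb{H}^{l\times I_2\times I_3\times\cdots\times I_N}$ is the tensor $\dot{\mathcal{C}}=\dot{\mathcal{A}}\star_{QT}\dot{\mathcal{B}}$ whose transform is $\hat{\dot{\mathcal{C}}}=\hat{\dot{\mathcal{A}}}\star_{QF}\hat{\dot{\mathcal{B}}}$. The conjugate transpose $\dot{\mathcal{A}}^H$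 is the tensor whose transform has frontal slices $\bigl(\hat{\dot{\mathcal{A}}}(:,:,i_3,\dots,i_N)\bigr)^H$. The identity quaternion tensor $\dot{\mathcal{I}}\in\mathbb{H}^{l\times l\times I_3\times\cdots\times I_N}$ is the tensor all of whose transformed frontal slices $\hat{\dot{\mathcal{I}}}(:,:,i_3,\dots,i_N)$ equal the $l\times l$ identity matrix. A tensor $\dot{\mathcal{U}}\in\mathbb{H}^{l\times l\times I_3\times\cdots\times I_N}$ is unitary if $\dot{\mathcal{U}}\star_{QT}\dot{\mathcal{U}}^H=\dot{\mathcal{I}}=\dot{\mathcal{U}}^H\star_{QT}\dot{\mathcal{U}}$. A (possibly rectangular) matrix is triangular if it is upper triangular or lower triangular. *)

theory Defs
  imports
    Complex_Main
    "HOL-Library.FuncSet"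
    "Jordan_Normal_Form.Matrix"
begin

section \<open>Quaternions\<close>

datatype quat = Quat (qRe: real) (qI: real) (qJ: real) (qK: real)

lemma quat_eq_iff:
  "p = q \<longleftrightarrow> qRe p = qRe q \<and> qI p = qI q \<and> qJ p = qJ q \<and> qK p = qK q"
  by (cases p; cases q) auto

instantiation quat :: ab_group_add
begin

definition zero_quat :: quat where "0 = Quat 0 0 0 0"

definition plus_quat :: "quat \<Rightarrow> quat \<Rightarrow> quat" where
  "p + q = Quat (qRe p + qRe q) (qI p + qI q) (qJ p + qJ q) (qK p + qK q)"

definition uminus_quat :: "quat \<Rightarrow> quat" where
  "- q = Quat (- qRe q) (- qI q) (- qJ q) (- qK q)"

definition minus_quat :: "quat \<Rightarrow> quat \<Rightarrow> quat" where
  "p - q = Quat (qRe p - qRe q) (qI p - qI q) (qJ p - qJ q) (qK p - qK q)"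

instance
  by standard (auto simp: quat_eq_iff zero_quat_def plus_quat_def uminus_quat_def minus_quat_def)

end

instantiation quat :: conjugate
begin

definition conjugate_quat :: "quat \<Rightarrow> quat" where
  "conjugate q = Quat (qRe q) (- qI q) (- qJ q) (- qK q)"

instance
  by standard (auto simp: quat_eq_iff conjugate_quat_def)

end

definition quat_normsq :: "quat \<Rightarrow> real" where
  "quat_normsq q = (qRe q)\<^sup>2 + (qI q)\<^sup>2 + (qJ q)\<^sup>2 + (qK q)\<^sup>2"

lemma quat_normsq_eq_0_iff: "quat_normsq q = 0 \<longleftrightarrow> q = 0"
  by (auto simp: quat_normsq_def quat_eq_iff zero_quat_def add_nonneg_eq_0_iff)

instantiation quat :: division_ring
begin

definition one_quat :: quat where "1 = Quat 1 0 0 0"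

definition times_quat :: "quat \<Rightarrow> quat \<Rightarrow> quat" where
  "p * q = Quat
     (qRe p * qRe q - qI p * qI q - qJ p * qJ q - qK p * qK q)
     (qRe p * qI q + qI p * qRe q + qJ p * qK q - qK p * qJ q)
     (qRe p * qJ q - qI p * qK q + qJ p * qRe q + qK p * qI q)
     (qRe p * qK q + qI p * qJ q - qJ p * qI q + qK p * qRe q)"

definition inverse_quat :: "quat \<Rightarrow> quat" where
  "inverse q = Quat (qRe q / quat_normsq q) (- qI q / quat_normsq q)
     (- qJ q / quat_normsq q) (- qK q / quat_normsq q)"

definition divide_quat :: "quat \<Rightarrow> quat \<Rightarrow> quat" where
  "divide_quat p q = p * inverse q"

instance
proof
  fix a b c :: quat
  show "a * b * c = a * (b * c)"
    by (simp add: quat_eq_iff times_quat_def algebra_simps)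
  show "1 * a = a" "a * 1 = a"
    by (simp_all add: quat_eq_iff times_quat_def one_quat_def)
  show "(a + b) * c = a * c + b * c" "a * (b + c) = a * b + a * c"
    by (simp_all add: quat_eq_iff times_quat_def plus_quat_def algebra_simps)
  show "(0::quat) \<noteq> 1"
    by (simp add: quat_eq_iff zero_quat_def one_quat_def)
  show "inverse (0::quat) = 0"
    by (simp add: inverse_quat_def quat_eq_iff zero_quat_def)
  show "divide a b = a * inverse b"
    by (simp add: divide_quat_def)
  assume "a \<noteq> 0"
  then have n: "quat_normsq a \<noteq> 0"
    by (simp add: quat_normsq_eq_0_iff)
  define r where "r = inverse (quat_normsq a)"
  have r: "(qRe a * qRe a + qI a * qI a + qJ a * qJ a + qK a * qK a) * r = 1"
    using n by (simp add: r_def quat_normsq_def power2_eq_square)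
  have inv: "inverse a = Quat (qRe a * r) (- qI a * r) (- qJ a * r) (- qK a * r)"
    by (simp add: inverse_quat_def r_def divide_inverse)
  have "inverse a * a = Quat ((qRe a * qRe a + qI a * qI a + qJ a * qJ a + qK a * qK a) * r) 0 0 0"
    and "a * inverse a = Quat ((qRe a * qRe a + qI a * qI a + qJ a * qJ a + qK a * qK a) * r) 0 0 0"
    unfolding inv times_quat_def by (simp_all add: algebra_simps)
  then show "inverse a * a = 1" "a * inverse a = 1"
    unfolding one_quat_def r by simp_all
qed

end


section \<open>Matrices over the quaternions\<close>

text \<open>
  \<open>mat_adjoint\<close> is restricted to fields and \<open>upper_triangular\<close> is meant for square matrices
  (it inspects the positions \<open>j < i\<close> even if \<open>j\<close> is not a column index), so neither fits.
\<close>

definition mat_hermitian :: "quat mat \<Rightarrow> quat mat" where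
  "mat_hermitian M = map_mat conjugate (transpose_mat M)"

definition rect_upper_triangular :: "'a::zero mat \<Rightarrow> bool" where
  "rect_upper_triangular M \<longleftrightarrow> (\<forall>i<dim_row M. \<forall>j<dim_col M. j < i \<longrightarrow> M $$ (i, j) = 0)"

definition rect_lower_triangular :: "'a::zero mat \<Rightarrow> bool" where
  "rect_lower_triangular M \<longleftrightarrow> (\<forall>i<dim_row M. \<forall>j<dim_col M. i < j \<longrightarrow> M $$ (i, j) = 0)"

definition triangular_mat :: "'a::zero mat \<Rightarrow> bool" where
  "triangular_mat M \<longleftrightarrow> rect_upper_triangular M \<or> rect_lower_triangular M"


section \<open>Tensors\<close>

definition multi_index :: "nat list \<Rightarrow> nat list set" where
  "multi_index ds = {ix. length ix = length ds \<and> (\<forall>k<length ds. ix ! k < ds ! k)}"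

text \<open>
  A tensor consists of the list of its dimensions and of its entries; as usual for matrices,
  multi-indices start at \<open>0\<close>.  Entries outside the index range are fixed
  by extensionality, so that equality of tensors means equal dimensions and equal entries.
  Modes are numbered from \<open>1\<close>: mode \<open>k\<close> sits at position \<open>k - 1\<close> of the lists.
\<close>

typedef 'a tensor = "{(ds :: nat list, f :: nat list \<Rightarrow> 'a). f \<in> extensional (multi_index ds)}"
  by (auto intro: exI[of _ "[]"] exI[of _ "\<lambda>_. undefined"] simp: extensional_def)

setup_lifting type_definition_tensor

lift_definition dims :: "'a tensor \<Rightarrow> nat list" is fst .

lift_definition entry :: "'a tensor \<Rightarrow> nat list \<Rightarrow> 'a" is snd .

lift_definition mk_tensor :: "nat list \<Rightarrow> (nat list \<Rightarrow> 'a) \<Rightarrow> 'a tensor"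
  is "\<lambda>ds f. (ds, restrict f (multi_index ds))"
  by auto

lemma dims_mk_tensor [simp]: "dims (mk_tensor ds f) = ds"
  by transfer simp

lemma entry_mk_tensor [simp]: "ix \<in> multi_index ds \<Longrightarrow> entry (mk_tensor ds f) ix = f ix"
  by transfer simp

lemma tensor_eqI:
  assumes "dims A = dims B"
    and "\<And>ix. ix \<in> multi_index (dims B) \<Longrightarrow> entry A ix = entry B ix"
  shows "A = B"
  using assms by transfer (auto intro: extensionalityI)

definition frontal_slice :: "'a tensor \<Rightarrow> nat list \<Rightarrow> 'a mat" where
  "frontal_slice A ix = mat (dims A ! 0) (dims A ! 1) (\<lambda>(i, j). entry A (i # j # ix))"

definition tensor_of_slices :: "nat \<Rightarrow> nat \<Rightarrow> nat list \<Rightarrow> (nat list \<Rightarrow> 'a mat) \<Rightarrow> 'a tensor" where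
  "tensor_of_slices m n ds S = mk_tensor (m # n # ds) (\<lambda>ix. S (drop 2 ix) $$ (ix ! 0, ix ! 1))"

text \<open>The mode-\<open>k\<close> fiber through the multi-index \<open>ix\<close>; it does not depend on the \<open>k\<close>-th index.\<close>

definition fiber :: "'a tensor \<Rightarrow> nat \<Rightarrow> nat list \<Rightarrow> 'a vec" where
  "fiber A k ix = vec (dims A ! (k - 1)) (\<lambda>j. entry A (ix[k - 1 := j]))"

definition mode_prod :: "'a::semiring_0 tensor \<Rightarrow> nat \<Rightarrow> 'a mat \<Rightarrow> 'a tensor" where
  "mode_prod A k M =
     mk_tensor ((dims A)[k - 1 := dim_row M]) (\<lambda>ix. (M *\<^sub>v fiber A k ix) $ (ix ! (k - 1)))"

text \<open>
  The transform \<open>A \<times>\<^sub>3 Q 3 \<times>\<^sub>4 \<dots> \<times>\<^sub>N Q N\<close>, where \<open>N\<close> is the order of \<open>A\<close>.  The order of the factors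
  matters because the entries do not commute.
\<close>

definition transform :: "(nat \<Rightarrow> 'a::semiring_0 mat) \<Rightarrow> 'a tensor \<Rightarrow> 'a tensor" where
  "transform Q A = fold (\<lambda>k B. mode_prod B k (Q k)) [3..<Suc (length (dims A))] A"

definition facewise_prod :: "'a::semiring_0 tensor \<Rightarrow> 'a tensor \<Rightarrow> 'a tensor" where
  "facewise_prod A B =
     tensor_of_slices (dims A ! 0) (dims B ! 1) (drop 2 (dims A))
       (\<lambda>ix. frontal_slice A ix * frontal_slice B ix)"

text \<open>
  The following tensors are specified by their transform; existence and uniqueness for invertible
  matrices \<open>Q 3, \<dots>, Q N\<close> are shown in \<open>ex1_transform\<close> below.
\<close>

definition qt_prod :: "(nat \<Rightarrow> 'a::semiring_0 mat) \<Rightarrow> 'a tensor \<Rightarrow> 'a tensor \<Rightarrow> 'a tensor" where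
  "qt_prod Q A B =
     (THE C. dims C = dims A ! 0 # dims B ! 1 # drop 2 (dims A) \<and>
        transform Q C = facewise_prod (transform Q A) (transform Q B))"

definition conj_transpose :: "(nat \<Rightarrow> quat mat) \<Rightarrow> quat tensor \<Rightarrow> quat tensor" where
  "conj_transpose Q A =
     (THE B. dims B = dims A ! 1 # dims A ! 0 # drop 2 (dims A) \<and>
        (\<forall>ix\<in>multi_index (drop 2 (dims A)).
           frontal_slice (transform Q B) ix = mat_hermitian (frontal_slice (transform Q A) ix)))"

definition id_tensor :: "(nat \<Rightarrow> 'a::semiring_1 mat) \<Rightarrow> nat \<Rightarrow> nat list \<Rightarrow> 'a tensor" where
  "id_tensor Q l ds =
     (THE E. dims E = l # l # ds \<and>
        (\<forall>ix\<in>multi_index ds. frontal_slice (transform Q E) ix = 1\<^sub>m l))"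

definition unitary_tensor :: "(nat \<Rightarrow> quat mat) \<Rightarrow> quat tensor \<Rightarrow> bool" where
  "unitary_tensor Q U \<longleftrightarrow>
     (\<exists>l ds. dims U = l # l # ds \<and>
        qt_prod Q U (conj_transpose Q U) = id_tensor Q l ds \<and>
        qt_prod Q (conj_transpose Q U) U = id_tensor Q l ds)"

text \<open>The slices of the tensor itself, not of its transform; each one may be upper or lower.\<close>

definition frontal_triangular :: "'a::zero tensor \<Rightarrow> bool" where
  "frontal_triangular T \<longleftrightarrow>
     (\<forall>ix\<in>multi_index (drop 2 (dims T)). triangular_mat (frontal_slice T ix))"


section \<open>The transform is a bijection\<close>

lemma multi_index_update:
  assumes "ix \<in> multi_index (ds[k := n])" "j < ds ! k"
  shows "ix[k := j] \<in> multi_index ds"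
proof -
  have len: "length ix = length ds"
    and lt: "\<And>m. m < length ds \<Longrightarrow> ix ! m < ds[k := n] ! m"
    using assms(1) by (simp_all add: multi_index_def)
  have "ix[k := j] ! m < ds ! m" if "m < length ds" for m
    using lt[OF that] assms(2) that len by (cases "m = k") simp_all
  then show ?thesis
    using len by (simp add: multi_index_def)
qed

lemma dims_mode_prod:
  assumes "M \<in> carrier_mat (dims A ! (k - 1)) (dims A ! (k - 1))"
  shows "dims (mode_prod A k M) = dims A"
  using assms by (simp add: mode_prod_def)

lemma entry_mode_prod:
  assumes "M \<in> carrier_mat (dims A ! (k - 1)) (dims A ! (k - 1))" "ix \<in> multi_index (dims A)"
  shows "entry (mode_prod A k M) ix = (M *\<^sub>v fiber A k ix) $ (ix ! (k - 1))"
proof -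
  have "(dims A)[k - 1 := dim_row M] = dims A"
    using assms(1) by simp
  then show ?thesis
    using assms(2) by (simp add: mode_prod_def)
qed

lemma mode_prod_mode_prod:
  fixes A :: "'a::semiring_1 tensor"
  assumes k: "k - 1 < length (dims A)" and n: "dims A ! (k - 1) = n"
    and M: "M \<in> carrier_mat n n" and P: "P \<in> carrier_mat n n"
  shows "mode_prod (mode_prod A k M) k P = mode_prod A k (P * M)"
proof (rule tensor_eqI)
  show "dims (mode_prod (mode_prod A k M) k P) = dims (mode_prod A k (P * M))"
    using M P by (simp add: mode_prod_def)
next
  fix ix assume "ix \<in> multi_index (dims (mode_prod A k (P * M)))"
  then have ix: "ix \<in> multi_index (dims A)"
    using dims_mode_prod[of "P * M" A k] M P n by simp
  have lt: "ix ! (k - 1) < n" and len: "length ix = length (dims A)"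
    using ix k n by (auto simp: multi_index_def)
  have d: "dims (mode_prod A k M) = dims A"
    using M n by (simp add: dims_mode_prod)
  have f: "fiber A k ix \<in> carrier_vec n"
    using n by (simp add: fiber_def)
  have "fiber (mode_prod A k M) k ix = M *\<^sub>v fiber A k ix"
  proof (rule eq_vecI)
    fix j assume "j < dim_vec (M *\<^sub>v fiber A k ix)"
    then have j: "j < n" using M by simp
    have jx: "ix[k - 1 := j] \<in> multi_index (dims A)"
      using multi_index_update[of ix "dims A" "k - 1" "dims A ! (k - 1)" j] ix j n by simp
    then have "entry (mode_prod A k M) (ix[k - 1 := j])
        = (M *\<^sub>v fiber A k (ix[k - 1 := j])) $ (ix[k - 1 := j] ! (k - 1))"
      using entry_mode_prod[of M A k, OF _ jx] M n by simp
    then show "fiber (mode_prod A k M) k ix $ j = (M *\<^sub>v fiber A k ix) $ j"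
      using j n d k len by (simp add: fiber_def)
  qed (use M n d in \<open>simp add: fiber_def\<close>)
  then have "P *\<^sub>v fiber (mode_prod A k M) k ix = (P * M) *\<^sub>v fiber A k ix"
    using assoc_mult_mat_vec[OF P M f] by simp
  then show "entry (mode_prod (mode_prod A k M) k P) ix = entry (mode_prod A k (P * M)) ix"
    using entry_mode_prod[of P "mode_prod A k M" k ix] entry_mode_prod[of "P * M" A k ix] ix M P n d
    by simp
qed

lemma mode_prod_one:
  fixes A :: "'a::semiring_1 tensor"
  assumes k: "k - 1 < length (dims A)"
  shows "mode_prod A k (1\<^sub>m (dims A ! (k - 1))) = A"
proof (rule tensor_eqI)
  fix ix assume ix: "ix \<in> multi_index (dims A)"
  have "fiber A k ix \<in> carrier_vec (dims A ! (k - 1))"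
    by (simp add: fiber_def)
  moreover have "ix ! (k - 1) < dims A ! (k - 1)"
    using ix k by (auto simp: multi_index_def)
  ultimately show "entry (mode_prod A k (1\<^sub>m (dims A ! (k - 1)))) ix = entry A ix"
    using ix by (simp add: mode_prod_def fiber_def)
qed (simp add: mode_prod_def)

lemma invertible_mat_obtain:
  fixes M :: "'a::semiring_1 mat"
  assumes "M \<in> carrier_mat n n" "invertible_mat M"
  obtains P where "P \<in> carrier_mat n n" "M * P = 1\<^sub>m n" "P * M = 1\<^sub>m n"
proof -
  from assms obtain P where P: "M * P = 1\<^sub>m n" "P * M = 1\<^sub>m (dim_row P)"
    by (auto simp: invertible_mat_def inverts_mat_def)
  have "dim_col (M * P) = n" using P(1) by simp
  then have c: "dim_col P = n" by simp
  have "dim_col (P * M) = dim_row P" using P(2) by simp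
  then have "dim_row P = n" using assms(1) by simp
  with c P show thesis using that by auto
qed

lemma ex1_fold_mode_prod:
  fixes Q :: "nat \<Rightarrow> 'a::semiring_1 mat"
  assumes "\<forall>k\<in>set ks. k - 1 < length ds \<and> Q k \<in> carrier_mat (ds ! (k - 1)) (ds ! (k - 1)) \<and>
             invertible_mat (Q k)"
    and "dims B = ds"
  shows "\<exists>!A. dims A = ds \<and> fold (\<lambda>k B. mode_prod B k (Q k)) ks A = B"
  using assms
proof (induction ks)
  case Nil
  then show ?case by auto
next
  case (Cons k ks)
  have "\<exists>!C. dims C = ds \<and> fold (\<lambda>k B. mode_prod B k (Q k)) ks C = B"
    using Cons by simp
  then obtain C where C: "dims C = ds" "fold (\<lambda>k B. mode_prod B k (Q k)) ks C = B"
    and uniq: "\<And>D. dims D = ds \<Longrightarrow> fold (\<lambda>k B. mode_prod B k (Q k)) ks D = B \<Longrightarrow> D = C"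
    by blast
  have k: "k - 1 < length ds" and Qk: "Q k \<in> carrier_mat (ds ! (k - 1)) (ds ! (k - 1))"
    and inv: "invertible_mat (Q k)"
    using Cons.prems by auto
  obtain P where P: "P \<in> carrier_mat (ds ! (k - 1)) (ds ! (k - 1))"
    and QP: "Q k * P = 1\<^sub>m (ds ! (k - 1))" and PQ: "P * Q k = 1\<^sub>m (ds ! (k - 1))"
    using invertible_mat_obtain[OF Qk inv] .
  show ?case
  proof (rule ex1I[of _ "mode_prod C k P"])
    have "mode_prod (mode_prod C k P) k (Q k) = mode_prod C k (Q k * P)"
      using C k Qk P by (intro mode_prod_mode_prod) auto
    also have "\<dots> = C"
      using mode_prod_one[of k C] C k QP by simp
    finally have "mode_prod (mode_prod C k P) k (Q k) = C" .
    then show "dims (mode_prod C k P) = ds \<and>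
        fold (\<lambda>k B. mode_prod B k (Q k)) (k # ks) (mode_prod C k P) = B"
      using C P dims_mode_prod[of P C k] by simp
  next
    fix A assume A: "dims A = ds \<and> fold (\<lambda>k B. mode_prod B k (Q k)) (k # ks) A = B"
    then have "mode_prod A k (Q k) = C"
      using uniq[of "mode_prod A k (Q k)"] dims_mode_prod[of "Q k" A k] Qk by simp
    then have "mode_prod C k P = mode_prod (mode_prod A k (Q k)) k P"
      by simp
    also have "\<dots> = mode_prod A k (P * Q k)"
      using A k Qk P by (intro mode_prod_mode_prod) auto
    also have "\<dots> = A"
      using mode_prod_one[of k A] A k PQ by simp
    finally show "A = mode_prod C k P" ..
  qed
qed

lemma ex1_transform:
  fixes Q :: "nat \<Rightarrow> 'a::semiring_1 mat"
  assumes "\<forall>k\<in>{3..length ds}. Q k \<in> carrier_mat (ds ! (k - 1)) (ds ! (k - 1)) \<and>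
             invertible_mat (Q k)"
    and "dims B = ds"
  shows "\<exists>!A. dims A = ds \<and> transform Q A = B"
proof -
  have eq: "(dims A = ds \<and> transform Q A = B) \<longleftrightarrow>
      (dims A = ds \<and> fold (\<lambda>k B. mode_prod B k (Q k)) [3..<Suc (length ds)] A = B)" for A
    unfolding transform_def by blast
  show ?thesis
    unfolding eq
  proof (rule ex1_fold_mode_prod)
    show "\<forall>k\<in>set [3..<Suc (length ds)]. k - 1 < length ds \<and>
        Q k \<in> carrier_mat (ds ! (k - 1)) (ds ! (k - 1)) \<and> invertible_mat (Q k)"
    proof
      fix k assume "k \<in> set [3..<Suc (length ds)]"
      then have "k \<in> {3..length ds}" by (simp del: upt_Suc)
      with assms(1) show "k - 1 < length ds \<and>
          Q k \<in> carrier_mat (ds ! (k - 1)) (ds ! (k - 1)) \<and> invertible_mat (Q k)"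
        by (force dest: bspec)
    qed
  qed (fact assms(2))
qed

lemma frontal_slice_tensor_of_slices:
  assumes "ix \<in> multi_index ds" "S ix \<in> carrier_mat m n"
  shows "frontal_slice (tensor_of_slices m n ds S) ix = S ix"
proof -
  have "i # j # ix \<in> multi_index (m # n # ds)" if "i < m" "j < n" for i j
    using assms(1) that by (auto simp: multi_index_def nth_Cons split: nat.splits)
  then show ?thesis
    using assms(2) by (intro eq_matI) (auto simp: frontal_slice_def tensor_of_slices_def)
qed

end

theory Submission
  imports Defs
begin

text \<open>
  Take for \<open>V\<close> the identity tensor and let the transforms of \<open>U\<close> and \<open>T\<close> consist of the factors of
  QR decompositions (by Householder reflections) of the transformed slices of \<open>A\<close>.  All slices of
  the transform of \<open>T\<close> are upper triangular, so its tubes \<open>(i, j, :)\<close> with \<open>j < i\<close> vanish.  Mode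
  products with the modes \<open>3, \<dots>, N\<close> act on each tube separately and are invertible, so the same
  tubes of \<open>T\<close> itself vanish.  (A lower triangular choice in some of the slices would break this.)
\<close>

section \<open>Quaternions\<close>

lemmas quat_ops = quat_eq_iff zero_quat_def one_quat_def plus_quat_def minus_quat_def
  uminus_quat_def times_quat_def conjugate_quat_def

definition quat_of_real :: "real \<Rightarrow> quat" where
  "quat_of_real r = Quat r 0 0 0"

lemma conjugate_quat_simps [simp]:
  fixes p q :: quat
  shows "conjugate (0::quat) = 0" "conjugate (1::quat) = 1"
    "conjugate (p + q) = conjugate p + conjugate q"
    "conjugate (p - q) = conjugate p - conjugate q"
    "conjugate (p * q) = conjugate q * conjugate p"
    "conjugate (quat_of_real r) = quat_of_real r"
  by (simp_all add: quat_ops quat_of_real_def)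

lemma conjugate_quat_sum: "conjugate (\<Sum>x\<in>X. f x :: quat) = (\<Sum>x\<in>X. conjugate (f x))"
  by (induction X rule: infinite_finite_induct) simp_all

lemma quat_of_real_simps [simp]:
  "quat_of_real 0 = 0" "quat_of_real 1 = 1"
  "quat_of_real a * quat_of_real b = quat_of_real (a * b)"
  "quat_of_real a + quat_of_real b = quat_of_real (a + b)"
  by (simp_all add: quat_ops quat_of_real_def)

lemma quat_of_real_sum: "quat_of_real (\<Sum>x\<in>X. f x) = (\<Sum>x\<in>X. quat_of_real (f x))"
  by (induction X rule: infinite_finite_induct) (simp_all flip: quat_of_real_simps(4))

lemma conjugate_mult_self: "conjugate q * q = quat_of_real (quat_normsq q)"
  by (simp add: quat_ops quat_of_real_def quat_normsq_def power2_eq_square)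

lemma quat_normsq_nonneg: "quat_normsq q \<ge> 0"
  by (simp add: quat_normsq_def)

text \<open>A nonzero \<open>q\<close> is divided by its absolute value; for \<open>q = 0\<close>
  the phase 1 with modulus 0 serves. A unit phase is thus always available, and in the Householder
  construction it replaces the sign of a real pivot.\<close>

lemma quat_polar:
  obtains u a where "q = u * quat_of_real a" "conjugate u * u = 1" "a \<ge> 0"
proof (cases "q = 0")
  case True
  then show thesis
    using that[of 1 0] by simp
next
  case False
  define a where "a = sqrt (quat_normsq q)"
  have n: "quat_normsq q > 0"
    using False quat_normsq_nonneg[of q] quat_normsq_eq_0_iff[of q] by linarith
  then have a: "a > 0" "quat_normsq q = a * a"
    by (simp_all add: a_def)
  define u where "u = q * quat_of_real (1 / a)"
  have "conjugate u * u = quat_of_real (1 / a) * (conjugate q * q) * quat_of_real (1 / a)"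
    by (simp add: u_def mult.assoc)
  also have "\<dots> = 1"
    using a by (simp add: conjugate_mult_self)
  finally show thesis
    using that[of u a] a by (simp add: u_def mult.assoc)
qed


section \<open>Quaternion matrices\<close>

lemma mat_hermitian_carrier [simp]:
  "M \<in> carrier_mat m n \<Longrightarrow> mat_hermitian M \<in> carrier_mat n m"
  by (simp add: mat_hermitian_def)

lemma index_mat_hermitian [simp]:
  "i < dim_col M \<Longrightarrow> j < dim_row M \<Longrightarrow> mat_hermitian M $$ (i, j) = conjugate (M $$ (j, i))"
  by (simp add: mat_hermitian_def)

lemma dim_mat_hermitian [simp]:
  "dim_row (mat_hermitian M) = dim_col M" "dim_col (mat_hermitian M) = dim_row M"
  by (simp_all add: mat_hermitian_def)

lemma mat_hermitian_one [simp]: "mat_hermitian (1\<^sub>m n) = 1\<^sub>m n"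
  by (rule eq_matI) auto

lemma mat_hermitian_mat_hermitian [simp]: "mat_hermitian (mat_hermitian M) = M"
  by (rule eq_matI) auto

lemma mat_hermitian_mult:
  assumes "A \<in> carrier_mat m l" "B \<in> carrier_mat l n"
  shows "mat_hermitian (A * B) = mat_hermitian B * mat_hermitian A"
proof (rule eq_matI)
  fix i j assume "i < dim_row (mat_hermitian B * mat_hermitian A)"
    "j < dim_col (mat_hermitian B * mat_hermitian A)"
  then show "mat_hermitian (A * B) $$ (i, j) = (mat_hermitian B * mat_hermitian A) $$ (i, j)"
    using assms by (simp add: scalar_prod_def conjugate_quat_sum)
qed (use assms in auto)

section \<open>Unitary quaternion matrices\<close>

definition unitary_mat :: "nat \<Rightarrow> quat mat \<Rightarrow> bool" where
  "unitary_mat n W \<longleftrightarrow>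
     W \<in> carrier_mat n n \<and> W * mat_hermitian W = 1\<^sub>m n \<and> mat_hermitian W * W = 1\<^sub>m n"

lemma unitary_mat_carrier: "unitary_mat n W \<Longrightarrow> W \<in> carrier_mat n n"
  by (simp add: unitary_mat_def)

lemma unitary_mat_one: "unitary_mat n (1\<^sub>m n)"
  by (simp add: unitary_mat_def)

lemma unitary_mat_hermitian: "unitary_mat n W \<Longrightarrow> unitary_mat n (mat_hermitian W)"
  by (simp add: unitary_mat_def)

text \<open>Isolates the cancellation that occurs in both halves of the unitarity of a
  product.\<close>

lemma mult_cancel_inner:
  fixes A B C D :: "'a::semiring_1 mat"
  assumes "A \<in> carrier_mat n n" "B \<in> carrier_mat n n" "C \<in> carrier_mat n n" "D \<in> carrier_mat n n"
    and "B * C = 1\<^sub>m n"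
  shows "(A * B) * (C * D) = A * D"
proof -
  have "(A * B) * (C * D) = A * (B * (C * D))"
    using assms by (intro assoc_mult_mat) auto
  also have "B * (C * D) = B * C * D"
    using assms by (intro assoc_mult_mat[symmetric]) auto
  finally show ?thesis
    using assms by simp
qed

lemma unitary_mat_mult:
  assumes "unitary_mat n P" "unitary_mat n W"
  shows "unitary_mat n (P * W)"
proof -
  have "P * W \<in> carrier_mat n n"
    using assms by (auto simp: unitary_mat_def)
  moreover have "mat_hermitian (P * W) = mat_hermitian W * mat_hermitian P"
    using assms by (intro mat_hermitian_mult) (auto simp: unitary_mat_def)
  ultimately show ?thesis
    using assms mult_cancel_inner[of P n W "mat_hermitian W" "mat_hermitian P"]
      mult_cancel_inner[of "mat_hermitian W" n "mat_hermitian P" P W]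
    by (simp add: unitary_mat_def)
qed

section \<open>Householder reflections and the QR decomposition\<close>

definition reflection :: "nat \<Rightarrow> (nat \<Rightarrow> quat) \<Rightarrow> quat mat" where
  "reflection m u = mat m m (\<lambda>(i, j). (if i = j then 1 else 0) - u i * conjugate (u j))"

lemma reflection_mult_vec:
  assumes "y \<in> carrier_vec m" "i < m"
  shows "(reflection m u *\<^sub>v y) $ i = y $ i - u i * (\<Sum>j<m. conjugate (u j) * y $ j)"
proof -
  have "(reflection m u *\<^sub>v y) $ i
      = (\<Sum>j<m. ((if i = j then 1 else 0) - u i * conjugate (u j)) * y $ j)"
    using assms by (simp add: reflection_def scalar_prod_def atLeast0LessThan)
  also have "\<dots> = (\<Sum>j<m. if i = j then y $ j else 0) - (\<Sum>j<m. u i * (conjugate (u j) * y $ j))"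
    by (simp only: sum_subtractf[symmetric]) (auto intro!: sum.cong simp: left_diff_distrib mult.assoc)
  also have "(\<Sum>j<m. if i = j then y $ j else 0) = y $ i"
    using assms by simp
  finally show ?thesis
    by (simp add: sum_distrib_left)
qed

text \<open>The matrix P = I - u u^H is self-adjoint, and its square I - 2 u u^H + u (u^H u) u^H
  collapses to I when u^H u = 2. Scaling \<open>u\<close> to squared norm 2 absorbs the usual factor
  2 of a Householder matrix.\<close>

lemma unitary_reflection:
  assumes "(\<Sum>j<m. conjugate (u j) * u j) = 1 + 1"
  shows "unitary_mat m (reflection m u)"
proof -
  let ?P = "reflection m u"
  have P: "?P \<in> carrier_mat m m"
    by (simp add: reflection_def)
  have sa: "mat_hermitian ?P = ?P"
    by (rule eq_matI) (auto simp: reflection_def)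
  have "?P * ?P = 1\<^sub>m m"
  proof (rule eq_matI)
    fix i j assume "i < dim_row (1\<^sub>m m :: quat mat)" "j < dim_col (1\<^sub>m m :: quat mat)"
    then have i: "i < m" and j: "j < m" by auto
    \<comment> \<open>This computes u^H P = u^H - (u^H u) u^H = -u^H, whence P P = P - u (u^H P) = P
      + u u^H = I.\<close>
    have "(\<Sum>l<m. conjugate (u l) * ?P $$ (l, j))
        = (\<Sum>l<m. if l = j then conjugate (u l) else 0)
          - (\<Sum>l<m. conjugate (u l) * u l * conjugate (u j))"
      unfolding sum_subtractf[symmetric]
      using j by (intro sum.cong) (auto simp: reflection_def right_diff_distrib mult.assoc)
    also have "\<dots> = conjugate (u j) - (1 + 1) * conjugate (u j)"
      using j by (simp add: sum_distrib_right[symmetric] assms)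
    finally have s: "(\<Sum>l<m. conjugate (u l) * ?P $$ (l, j)) = - conjugate (u j)"
      unfolding distrib_right by simp
    have "(?P * ?P) $$ (i, j) = (?P *\<^sub>v col ?P j) $ i"
      using i j P by simp
    also have "\<dots> = ?P $$ (i, j) - u i * (\<Sum>l<m. conjugate (u l) * ?P $$ (l, j))"
      using reflection_mult_vec[of "col ?P j" m i u] i j P by simp
    also have "\<dots> = (if i = j then 1 else 0)"
      unfolding s using i j by (simp add: reflection_def)
    finally show "(?P * ?P) $$ (i, j) = 1\<^sub>m m $$ (i, j)"
      using i j by simp
  qed (use P in auto)
  then show ?thesis
    using P sa by (simp add: unitary_mat_def)
qed

text \<open>The reflection sends the part of \<open>v\<close> from \<open>k\<close> on to a multiple
  of the \<open>k\<close>-th unit vector. Its reflecting vector vanishes before \<open>k\<close>,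
  which gives the last property: it protects columns that have already been cleared.\<close>

lemma householder:
  assumes v: "v \<in> carrier_vec m" and k: "k < m"
  obtains P where "unitary_mat m P"
    and "\<And>i. k < i \<Longrightarrow> i < m \<Longrightarrow> (P *\<^sub>v v) $ i = 0"
    and "\<And>y. y \<in> carrier_vec m \<Longrightarrow> (\<And>i. k \<le> i \<Longrightarrow> i < m \<Longrightarrow> y $ i = 0) \<Longrightarrow> P *\<^sub>v y = y"
proof -
  obtain p a where p: "v $ k = p * quat_of_real a" "conjugate p * p = 1" and a: "a \<ge> 0"
    by (rule quat_polar)
  define s where "s = (\<Sum>j\<in>{k<..<m}. quat_normsq (v $ j))"
  \<comment> \<open>Since \<open>a\<close> is the modulus of the pivot \<open>v $ k\<close>,
    \<open>r\<close> is the Euclidean norm of the part of \<open>v\<close> from \<open>k\<close>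
    on.\<close>
  define r where "r = sqrt (s + a\<^sup>2)"
  define h where "h = r\<^sup>2 + a * r"
  have s: "s \<ge> 0"
    unfolding s_def by (intro sum_nonneg quat_normsq_nonneg)
  then have r: "r\<^sup>2 = s + a\<^sup>2" "r \<ge> 0"
    by (simp_all add: r_def)
  show thesis
  proof (cases "h = 0")
    \<comment> \<open>Both summands of \<open>h\<close> are nonnegative, so \<open>r\<close> is 0
      and \<open>v\<close> already vanishes beyond \<open>k\<close>; the identity matrix
      suffices.\<close>
    case True
    then have "s = 0"
      using r s a by (simp add: h_def add_nonneg_eq_0_iff)
    then have "\<forall>j\<in>{k<..<m}. quat_normsq (v $ j) = 0"
      unfolding s_def by (subst (asm) sum_nonneg_eq_0_iff) (auto simp: quat_normsq_nonneg)
    then show thesis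
      using v by (intro that[of "1\<^sub>m m"]) (auto simp: unitary_mat_one quat_normsq_eq_0_iff)
  next
    case False
    have "h \<ge> 0"
      unfolding h_def using r(2) a by (intro add_nonneg_nonneg mult_nonneg_nonneg) simp_all
    with False have h: "h > 0" by simp
    define t where "t = 1 / sqrt h"
    have t: "t * t * h = 1"
      using h by (simp add: t_def)
    \<comment> \<open>The vector \<open>w\<close> is the part of \<open>v\<close> from \<open>k\<close> on, moved by \<open>p * r\<close> in the direction of the
      \<open>k\<close>-th unit vector; its squared norm is \<open>2 * h\<close> and its inner product with \<open>v\<close> is \<open>h\<close>.\<close>
    define w where "w j = (if j < k then 0 else if j = k then p * quat_of_real (a + r) else v $ j)"
      for j
    \<comment> \<open>The factor \<open>t\<close> reduces the squared norm \<open>2 * h\<close> to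
      2. Placed on the right, it meets its conjugate copy in u u^H, so that the two factors
      \<open>t\<close> can cancel against \<open>h\<close>.\<close>
    define u where "u j = w j * quat_of_real t" for j
    have split: "(\<Sum>j<m. f j) = f k + (\<Sum>j\<in>{k<..<m}. f j)" if "\<And>j. j < k \<Longrightarrow> f j = 0"
      for f :: "nat \<Rightarrow> quat"
    proof -
      have "(\<Sum>j<m. f j) = (\<Sum>j\<in>insert k {k<..<m}. f j)"
        using k that by (intro sum.mono_neutral_right) (auto simp: not_less_iff_gr_or_eq)
      then show ?thesis by simp
    qed
    have tail: "(\<Sum>j\<in>{k<..<m}. conjugate (w j) * f j) = quat_of_real s"
      if "\<And>j. k < j \<Longrightarrow> f j = v $ j" for f
      unfolding s_def quat_of_real_sum
      using that by (intro sum.cong) (auto simp: w_def conjugate_mult_self)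
    \<comment> \<open>The phase \<open>p\<close> cancels against its conjugate and leaves a real
      number; this is why the pivot of \<open>w\<close> carries the same phase as the pivot of
      \<open>v\<close>.\<close>
    have wk: "conjugate (w k) * (p * quat_of_real b) = quat_of_real ((a + r) * b)" for b
    proof -
      have "conjugate (w k) * (p * quat_of_real b)
          = quat_of_real (a + r) * (conjugate p * p) * quat_of_real b"
        unfolding w_def by (simp add: mult.assoc del: quat_of_real_simps(4))
      then show ?thesis
        using p by simp
    qed
    have wwk: "conjugate (w k) * w k = quat_of_real ((a + r) * (a + r))"
      using wk[of "a + r"] by (simp add: w_def)
    have "(\<Sum>j<m. conjugate (w j) * w j)
        = conjugate (w k) * w k + (\<Sum>j\<in>{k<..<m}. conjugate (w j) * w j)"
      by (rule split) (simp add: w_def)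
    also have "(\<Sum>j\<in>{k<..<m}. conjugate (w j) * w j) = quat_of_real s"
      by (rule tail) (simp add: w_def)
    finally have ww: "(\<Sum>j<m. conjugate (w j) * w j) = quat_of_real (h + h)"
      unfolding wwk using r by (simp add: h_def power2_eq_square algebra_simps)
    have "(\<Sum>j<m. conjugate (w j) * v $ j)
        = conjugate (w k) * v $ k + (\<Sum>j\<in>{k<..<m}. conjugate (w j) * v $ j)"
      by (rule split) (simp add: w_def)
    also have "(\<Sum>j\<in>{k<..<m}. conjugate (w j) * v $ j) = quat_of_real s"
      by (rule tail) simp
    finally have wv: "(\<Sum>j<m. conjugate (w j) * v $ j) = quat_of_real h"
      unfolding p wk using r by (simp add: h_def power2_eq_square algebra_simps)
    have ip: "(\<Sum>j<m. conjugate (u j) * y j) = quat_of_real t * (\<Sum>j<m. conjugate (w j) * y j)" for y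
      by (simp add: u_def sum_distrib_left mult.assoc)
    have "(\<Sum>j<m. conjugate (u j) * u j)
        = quat_of_real t * (\<Sum>j<m. conjugate (w j) * w j) * quat_of_real t"
      unfolding ip by (simp add: u_def sum_distrib_right mult.assoc)
    also have "\<dots> = quat_of_real (t * t * h + t * t * h)"
      unfolding ww by (simp add: algebra_simps)
    finally have uu: "(\<Sum>j<m. conjugate (u j) * u j) = 1 + 1"
      unfolding t by (simp only: quat_of_real_simps(4)[symmetric] quat_of_real_simps(2))
    show thesis
    proof (rule that[of "reflection m u"])
      show "unitary_mat m (reflection m u)"
        using uu by (rule unitary_reflection)
    next
      fix i assume i: "k < i" "i < m"
      \<comment> \<open>Here u u^H v = w t t h = w, and \<open>w\<close> agrees with
        \<open>v\<close> beyond \<open>k\<close>, so the reflection subtracts exactly the entry to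
        be removed.\<close>
      have "u i * (\<Sum>j<m. conjugate (u j) * v $ j) = v $ i * quat_of_real (t * t * h)"
        unfolding ip wv using i by (simp add: u_def w_def mult.assoc)
      then show "(reflection m u *\<^sub>v v) $ i = 0"
        using i v t by (simp add: reflection_mult_vec)
    next
      fix y :: "quat vec"
      assume y: "y \<in> carrier_vec m" and 0: "\<And>i. k \<le> i \<Longrightarrow> i < m \<Longrightarrow> y $ i = 0"
      \<comment> \<open>The supports of \<open>u\<close> and \<open>y\<close> are disjoint: one
        starts at \<open>k\<close>, the other ends before it.\<close>
      have "conjugate (u j) * y $ j = 0" if "j < m" for j
        using 0[of j] that by (cases "j < k") (simp_all add: u_def w_def)
      then have z: "(\<Sum>j<m. conjugate (u j) * y $ j) = 0"
        by (intro sum.neutral) blast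
      show "reflection m u *\<^sub>v y = y"
      proof (rule eq_vecI)
        fix i assume "i < dim_vec y"
        then show "(reflection m u *\<^sub>v y) $ i = y $ i"
          using y z by (simp add: reflection_mult_vec)
      qed (use y in \<open>simp add: reflection_def\<close>)
    qed
  qed
qed

text \<open>Induction on the number of cleared columns: a Householder reflection with pivot
  \<open>k\<close> clears column \<open>k\<close> below the diagonal without disturbing the columns
  before it.\<close>

lemma unitary_triangularization:
  assumes M: "M \<in> carrier_mat m n" and "k \<le> n"
  shows "\<exists>W. unitary_mat m W \<and> (\<forall>i<m. \<forall>j<k. j < i \<longrightarrow> (W * M) $$ (i, j) = 0)"
  using \<open>k \<le> n\<close>
proof (induction k)
  case 0
  then show ?case
    using unitary_mat_one by blast
next
  case (Suc k)
  then obtain W where W: "unitary_mat m W"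
    and tri: "\<And>i j. i < m \<Longrightarrow> j < k \<Longrightarrow> j < i \<Longrightarrow> (W * M) $$ (i, j) = 0"
    by auto
  define B where "B = W * M"
  have Wc: "W \<in> carrier_mat m m"
    using W by (rule unitary_mat_carrier)
  have B: "B \<in> carrier_mat m n"
    unfolding B_def using Wc M by simp
  show ?case
  proof (cases "k < m")
    \<comment> \<open>Column \<open>k\<close> has no entry below the diagonal when \<open>k\<close>
      is at least the number of rows, so the old \<open>W\<close> is kept.\<close>
    case False
    then show ?thesis
      using W tri by (intro exI[of _ W]) auto
  next
    case True
    obtain P where P: "unitary_mat m P"
      and P0: "\<And>i. k < i \<Longrightarrow> i < m \<Longrightarrow> (P *\<^sub>v col B k) $ i = 0"
      and Pfix: "\<And>y. y \<in> carrier_vec m \<Longrightarrow> (\<And>i. k \<le> i \<Longrightarrow> i < m \<Longrightarrow> y $ i = 0) \<Longrightarrow> P *\<^sub>v y = y"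
      using householder[OF _ True, of "col B k"] B by (metis col_dim carrier_matD(1))
    have Pc: "P \<in> carrier_mat m m"
      using P by (rule unitary_mat_carrier)
    have "(P * W * M) $$ (i, j) = 0" if ij: "i < m" "j < Suc k" "j < i" for i j
    proof -
      have jn: "j < n"
        using ij Suc.prems by simp
      have "P * W * M = P * B"
        unfolding B_def using Pc Wc M by (rule assoc_mult_mat)
      then have e: "(P * W * M) $$ (i, j) = (P *\<^sub>v col B j) $ i"
        using ij jn Pc B by simp
      show ?thesis
      proof (cases "j = k")
        case True
        then show ?thesis
          using e P0 ij by simp
      next
        case False
        then have jk: "j < k" using ij by simp
        \<comment> \<open>An earlier column is zero below row \<open>j\<close>, in particular from
          row \<open>k\<close> on, so the reflection fixes it.\<close>
        have "P *\<^sub>v col B j = col B j"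
          using B jk jn tri by (intro Pfix) (auto simp: B_def[symmetric])
        then show ?thesis
          using e B ij jn tri[of i j] jk by (simp add: B_def[symmetric])
      qed
    qed
    then show ?thesis
      using unitary_mat_mult[OF P W] by blast
  qed
qed

text \<open>Once W M is upper triangular for a unitary W, the factors are W^H and W M.\<close>

theorem quat_qr_decomposition:
  assumes M: "M \<in> carrier_mat m n"
  obtains U R where "unitary_mat m U" "R \<in> carrier_mat m n" "rect_upper_triangular R" "M = U * R"
proof -
  obtain W where W: "unitary_mat m W"
    and tri: "\<forall>i<m. \<forall>j<n. j < i \<longrightarrow> (W * M) $$ (i, j) = 0"
    using unitary_triangularization[OF M, of n] by auto
  have Wc: "W \<in> carrier_mat m m" and inv: "mat_hermitian W * W = 1\<^sub>m m"
    using W by (simp_all add: unitary_mat_def)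
  have "mat_hermitian W * (W * M) = mat_hermitian W * W * M"
    using Wc M by (intro assoc_mult_mat[symmetric]) auto
  then have "M = mat_hermitian W * (W * M)"
    using inv M by simp
  moreover have "W * M \<in> carrier_mat m n"
    using Wc M by simp
  moreover have "rect_upper_triangular (W * M)"
    using tri Wc M by (simp add: rect_upper_triangular_def del: index_mult_mat(1))
  ultimately show thesis
    using that[of "mat_hermitian W" "W * M"] unitary_mat_hermitian[OF W] by blast
qed


section \<open>Tensors given by the slices of their transform\<close>

lemma frontal_slice_carrier [simp]:
  "dims A = m # n # ds \<Longrightarrow> frontal_slice A ix \<in> carrier_mat m n"
  by (simp add: frontal_slice_def)

lemma multi_index_Cons2:
  "ix \<in> multi_index (m # n # ds) \<longleftrightarrow>
     (\<exists>i j jx. ix = i # j # jx \<and> i < m \<and> j < n \<and> jx \<in> multi_index ds)"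
  by (cases ix; cases "tl ix") (auto simp: multi_index_def All_less_Suc2 nth_Cons')

lemma tensor_eqI_slices:
  assumes A: "dims A = m # n # ds" and B: "dims B = m # n # ds"
    and eq: "\<And>ix. ix \<in> multi_index ds \<Longrightarrow> frontal_slice A ix = frontal_slice B ix"
  shows "A = B"
proof (rule tensor_eqI)
  fix ix assume "ix \<in> multi_index (dims B)"
  then obtain i j jx where ix: "ix = i # j # jx" "i < m" "j < n" "jx \<in> multi_index ds"
    unfolding B multi_index_Cons2 by blast
  have "frontal_slice A jx $$ (i, j) = frontal_slice B jx $$ (i, j)"
    using eq ix by simp
  then show "entry A ix = entry B ix"
    using A B ix by (simp add: frontal_slice_def)
qed (simp add: A B)

text \<open>For \<open>k \<ge> 3\<close> a mode-\<open>k\<close> fiber keeps its first two indices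
  fixed, so a fiber that meets a zero tube lies inside it and is the zero vector.\<close>

lemma zero_tube_mode_prod:
  fixes A :: "'a::semiring_0 tensor"
  assumes k: "k \<ge> 3" and M: "M \<in> carrier_mat (dims A ! (k - 1)) (dims A ! (k - 1))"
    and d: "k - 1 < length (dims A)"
    and 0: "\<And>ix. ix \<in> multi_index (dims A) \<Longrightarrow> ix ! 0 = i \<Longrightarrow> ix ! 1 = j \<Longrightarrow> entry A ix = 0"
    and ix: "ix \<in> multi_index (dims A)" "ix ! 0 = i" "ix ! 1 = j"
  shows "entry (mode_prod A k M) ix = 0"
proof -
  have "fiber A k ix = 0\<^sub>v (dims A ! (k - 1))"
  proof (rule eq_vecI)
    fix l assume "l < dim_vec (0\<^sub>v (dims A ! (k - 1)) :: 'a vec)"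
    then have l: "l < dims A ! (k - 1)" by simp
    have "ix[k - 1 := l] \<in> multi_index (dims A)"
      using multi_index_update[of ix "dims A" "k - 1" "dims A ! (k - 1)" l] ix l by simp
    then have "entry A (ix[k - 1 := l]) = 0"
      using k ix by (intro 0) auto
    then show "fiber A k ix $ l = 0\<^sub>v (dims A ! (k - 1)) $ l"
      using l by (simp add: fiber_def)
  qed (simp add: fiber_def)
  moreover have "ix ! (k - 1) < dims A ! (k - 1)"
    using ix d by (auto simp: multi_index_def)
  ultimately show ?thesis
    using entry_mode_prod[OF M ix(1)] M by simp
qed

text \<open>Only the trailing dimensions are fixed, because tensors with different first two
  dimensions share the same matrices. As \<open>ds\<close> starts with mode 3, mode \<open>k\<close>
  has position \<open>k - 3\<close> in it.\<close>

locale tensor_transform =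
  fixes Q :: "nat \<Rightarrow> 'a::semiring_1 mat" and ds :: "nat list"
  assumes Q: "\<And>k. 3 \<le> k \<Longrightarrow> k \<le> length ds + 2 \<Longrightarrow>
    Q k \<in> carrier_mat (ds ! (k - 3)) (ds ! (k - 3)) \<and> invertible_mat (Q k)"
begin

lemma Q_dims:
  assumes "k \<in> {3..length ds + 2}"
  shows "Q k \<in> carrier_mat ((m # n # ds) ! (k - 1)) ((m # n # ds) ! (k - 1))"
    "invertible_mat (Q k)" "k - 1 < length (m # n # ds)"
proof -
  have "k - 1 = Suc (Suc (k - 3))"
    using assms by auto
  then show "Q k \<in> carrier_mat ((m # n # ds) ! (k - 1)) ((m # n # ds) ! (k - 1))"
    "invertible_mat (Q k)" "k - 1 < length (m # n # ds)"
    using Q[of k] assms by auto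
qed

lemma dims_fold_mode_prod:
  assumes "set ks \<subseteq> {3..length ds + 2}" "dims A = m # n # ds"
  shows "dims (fold (\<lambda>k B. mode_prod B k (Q k)) ks A) = m # n # ds"
  using assms
proof (induction ks arbitrary: A)
  case (Cons k ks)
  then have "dims (mode_prod A k (Q k)) = m # n # ds"
    using Q_dims(1)[of k m n] dims_mode_prod[of "Q k" A k] by simp
  then show ?case
    using Cons by simp
qed simp

lemma set_modes: "set [3..<Suc (length (m # n # ds))] \<subseteq> {3..length ds + 2}"
  by auto

lemma dims_transform: "dims A = m # n # ds \<Longrightarrow> dims (transform Q A) = m # n # ds"
  unfolding transform_def by (metis dims_fold_mode_prod set_modes)

lemma ex1_transform':
  assumes "dims B = m # n # ds"
  shows "\<exists>!A. dims A = m # n # ds \<and> transform Q A = B"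
proof (rule ex1_transform[OF _ assms], rule ballI)
  fix k assume "k \<in> {3..length (m # n # ds)}"
  then show "Q k \<in> carrier_mat ((m # n # ds) ! (k - 1)) ((m # n # ds) ! (k - 1)) \<and>
      invertible_mat (Q k)"
    using Q_dims[of k] by auto
qed

text \<open>This is the inverse transform of a family of slices. Writing every tensor in this form
  turns the tensor operations into slicewise matrix operations.\<close>

definition of_hat_slices :: "nat \<Rightarrow> nat \<Rightarrow> (nat list \<Rightarrow> 'a mat) \<Rightarrow> 'a tensor" where
  "of_hat_slices m n S =
     (THE A. dims A = m # n # ds \<and> transform Q A = tensor_of_slices m n ds S)"

lemma of_hat_slices_aux:
  "dims (of_hat_slices m n S) = m # n # ds \<and>
   transform Q (of_hat_slices m n S) = tensor_of_slices m n ds S"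
  unfolding of_hat_slices_def
  by (rule theI', rule ex1_transform') (simp add: tensor_of_slices_def)

lemma dims_of_hat_slices [simp]: "dims (of_hat_slices m n S) = m # n # ds"
  using of_hat_slices_aux by simp

lemma slice_of_hat_slices:
  "ix \<in> multi_index ds \<Longrightarrow> S ix \<in> carrier_mat m n \<Longrightarrow>
     frontal_slice (transform Q (of_hat_slices m n S)) ix = S ix"
  using of_hat_slices_aux by (simp add: frontal_slice_tensor_of_slices)

text \<open>Injectivity of the transform: the transformed slices determine the tensor.\<close>

lemma eq_of_hat_slices:
  assumes A: "dims A = m # n # ds" and S: "\<And>ix. ix \<in> multi_index ds \<Longrightarrow> S ix \<in> carrier_mat m n"
    and eq: "\<And>ix. ix \<in> multi_index ds \<Longrightarrow> frontal_slice (transform Q A) ix = S ix"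
  shows "A = of_hat_slices m n S"
proof -
  have "transform Q A = transform Q (of_hat_slices m n S)"
    using A S eq by (intro tensor_eqI_slices[of _ m n ds]) (simp_all add: dims_transform slice_of_hat_slices)
  then show ?thesis
    using ex1_transform'[of "transform Q A" m n] A dims_transform[OF A] dims_of_hat_slices by metis
qed

text \<open>After the dimensions are evaluated, both sides are the same definite
  description.\<close>

lemma qt_prod_eq:
  assumes A: "dims A = m # l # ds" and B: "dims B = l # n # ds"
  shows "qt_prod Q A B =
    of_hat_slices m n (\<lambda>ix. frontal_slice (transform Q A) ix * frontal_slice (transform Q B) ix)"
  unfolding qt_prod_def of_hat_slices_def facewise_prod_def
  by (simp add: A B dims_transform[OF A] dims_transform[OF B])

lemma qt_prod_of_hat_slices:
  assumes "\<And>ix. ix \<in> multi_index ds \<Longrightarrow> S ix \<in> carrier_mat m l"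
    and "\<And>ix. ix \<in> multi_index ds \<Longrightarrow> R ix \<in> carrier_mat l n"
  shows "qt_prod Q (of_hat_slices m l S) (of_hat_slices l n R) =
    of_hat_slices m n (\<lambda>ix. S ix * R ix)"
proof (subst qt_prod_eq[of _ m l _ n], simp, simp, rule eq_of_hat_slices)
  fix ix assume ix: "ix \<in> multi_index ds"
  then show "S ix * R ix \<in> carrier_mat m n"
    using assms by (meson mult_carrier_mat)
  then show "frontal_slice (transform Q (of_hat_slices m n
      (\<lambda>ix. frontal_slice (transform Q (of_hat_slices m l S)) ix *
            frontal_slice (transform Q (of_hat_slices l n R)) ix))) ix = S ix * R ix"
    using assms ix by (subst slice_of_hat_slices) (auto simp: slice_of_hat_slices)
qed simp

lemma id_tensor_eq: "id_tensor Q l ds = of_hat_slices l l (\<lambda>_. 1\<^sub>m l)"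
  unfolding id_tensor_def
  by (rule the_equality) (auto simp: slice_of_hat_slices intro: eq_of_hat_slices)

lemma of_hat_slices_cong:
  assumes "\<And>ix. ix \<in> multi_index ds \<Longrightarrow> S ix \<in> carrier_mat m n"
    and "\<And>ix. ix \<in> multi_index ds \<Longrightarrow> S ix = R ix"
  shows "of_hat_slices m n S = of_hat_slices m n R"
  using assms by (intro eq_of_hat_slices) (auto simp: slice_of_hat_slices)

text \<open>Zeros are carried backwards, from the transformed tensor to the original one. The fold
  applies its head first, so the induction hypothesis concerns the tensor after the first mode
  product, and multiplication by the inverse matrix then recovers \<open>A\<close>.\<close>

lemma zero_tube_fold_mode_prod:
  assumes "set ks \<subseteq> {3..length ds + 2}" "dims A = m # n # ds"
    and "\<And>ix. ix \<in> multi_index (m # n # ds) \<Longrightarrow> ix ! 0 = i \<Longrightarrow> ix ! 1 = j \<Longrightarrow>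
      entry (fold (\<lambda>k B. mode_prod B k (Q k)) ks A) ix = 0"
    and "ix \<in> multi_index (m # n # ds)" "ix ! 0 = i" "ix ! 1 = j"
  shows "entry A ix = 0"
  using assms
proof (induction ks arbitrary: A ix)
  case (Cons k ks)
  let ?d = "(m # n # ds) ! (k - 1)" and ?B = "mode_prod A k (Q k)"
  have k: "k \<in> {3..length ds + 2}"
    using Cons.prems by simp
  note Qk = Q_dims(1)[OF k, of m n] Q_dims(2)[OF k] Q_dims(3)[OF k, of m n]
  obtain P where P: "P \<in> carrier_mat ?d ?d" "P * Q k = 1\<^sub>m ?d"
    using invertible_mat_obtain[OF Qk(1,2)] .
  have dB: "dims ?B = m # n # ds"
    using Qk Cons.prems(2) dims_mode_prod[of "Q k" A k] by simp
  have "entry ?B ix = 0" if "ix \<in> multi_index (m # n # ds)" "ix ! 0 = i" "ix ! 1 = j" for ix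
    using Cons.IH[OF _ dB _ that] Cons.prems(1,3) by simp
  \<comment> \<open>The inverse \<open>P\<close> acts along the same mode \<open>k \<ge> 3\<close>,
    so it preserves the zero tube as well.\<close>
  then have "entry (mode_prod ?B k P) ix = 0"
    using Cons.prems dB Qk(3) P k
    by (intro zero_tube_mode_prod[of k P ?B i j ix]) auto
  also have "mode_prod ?B k P = mode_prod A k (P * Q k)"
    using Qk P Cons.prems(2) by (intro mode_prod_mode_prod) auto
  also have "\<dots> = A"
    using mode_prod_one[of k A] Qk(3) P Cons.prems(2) by simp
  finally show ?case .
qed simp

text \<open>Since all transformed slices are upper triangular, each position below the diagonal
  vanishes in every slice at once. That makes it a whole zero tube, which can be carried
  back.\<close>

lemma frontal_slice_upper_triangular:
  assumes S: "\<And>ix. ix \<in> multi_index ds \<Longrightarrow> S ix \<in> carrier_mat m n \<and> rect_upper_triangular (S ix)"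
    and ix: "ix \<in> multi_index ds"
  shows "rect_upper_triangular (frontal_slice (of_hat_slices m n S) ix)"
  unfolding rect_upper_triangular_def
proof (intro allI impI)
  let ?T = "of_hat_slices m n S"
  fix i j assume "i < dim_row (frontal_slice ?T ix)" "j < dim_col (frontal_slice ?T ix)" and ji: "j < i"
  then have i: "i < m" and j: "j < n"
    by (simp_all add: frontal_slice_def)
  have "entry ?T (i # j # ix) = 0"
  proof (rule zero_tube_fold_mode_prod[where A = ?T and m = m and n = n and i = i and j = j,
        OF set_modes[of m n] dims_of_hat_slices])
    fix jx assume jx: "jx \<in> multi_index (m # n # ds)" "jx ! 0 = i" "jx ! 1 = j"
    then obtain kx where kx: "jx = i # j # kx" "kx \<in> multi_index ds"
      unfolding multi_index_Cons2 by auto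
    have "S kx $$ (i, j) = 0"
      using S[OF kx(2)] i j ji by (auto simp: rect_upper_triangular_def)
    then have "frontal_slice (transform Q ?T) kx $$ (i, j) = 0"
      using S kx by (simp add: slice_of_hat_slices)
    then have "entry (transform Q ?T) jx = 0"
      using i j kx dims_transform[OF dims_of_hat_slices, of m n S] by (simp add: frontal_slice_def)
    then show "entry (fold (\<lambda>k B. mode_prod B k (Q k)) [3..<Suc (length (m # n # ds))] ?T) jx = 0"
      by (simp only: transform_def dims_of_hat_slices)
  qed (use i j ix in \<open>auto simp: multi_index_Cons2\<close>)
  then show "frontal_slice ?T ix $$ (i, j) = 0"
    using i j by (simp add: frontal_slice_def)
qed

end

section \<open>Conjugate transposes, unitary tensors and the decomposition\<close>

locale quat_tensor_transform = tensor_transform Q ds for Q :: "nat \<Rightarrow> quat mat" and ds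
begin

lemma conj_transpose_of_hat_slices:
  assumes S: "\<And>ix. ix \<in> multi_index ds \<Longrightarrow> S ix \<in> carrier_mat m n"
  shows "conj_transpose Q (of_hat_slices m n S) = of_hat_slices n m (\<lambda>ix. mat_hermitian (S ix))"
  unfolding conj_transpose_def
  by (rule the_equality) (use S in \<open>auto simp: slice_of_hat_slices intro!: eq_of_hat_slices\<close>)

text \<open>Both tensor equations reduce to the matrix equations in each transformed slice.\<close>

lemma unitary_of_hat_slices:
  assumes S: "\<And>ix. ix \<in> multi_index ds \<Longrightarrow> unitary_mat m (S ix)"
  shows "unitary_tensor Q (of_hat_slices m m S)"
proof -
  have c: "\<And>ix. ix \<in> multi_index ds \<Longrightarrow> S ix \<in> carrier_mat m m"
    using S unitary_mat_carrier by blast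
  have "of_hat_slices m m (\<lambda>ix. S ix * mat_hermitian (S ix)) = of_hat_slices m m (\<lambda>_. 1\<^sub>m m)"
    "of_hat_slices m m (\<lambda>ix. mat_hermitian (S ix) * S ix) = of_hat_slices m m (\<lambda>_. 1\<^sub>m m)"
    using S by (auto intro!: of_hat_slices_cong simp: unitary_mat_def)
  then show ?thesis
    unfolding unitary_tensor_def using c
    by (simp add: conj_transpose_of_hat_slices qt_prod_of_hat_slices id_tensor_eq)
qed

theorem qt_triangular_decomposition:
  assumes A: "dims A = m # n # ds"
  shows "\<exists>U T V. dims U = m # m # ds \<and> dims T = m # n # ds \<and> dims V = n # n # ds \<and>
    unitary_tensor Q U \<and> unitary_tensor Q V \<and> frontal_triangular T \<and>
    A = qt_prod Q (qt_prod Q U T) (conj_transpose Q V)"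
proof -
  let ?S = "\<lambda>ix. frontal_slice (transform Q A) ix"
  have S: "?S ix \<in> carrier_mat m n" for ix
    using dims_transform[OF A] by simp
  \<comment> \<open>\<open>frontal_slice\<close> has the right shape for every list
    \<open>ix\<close>, even outside the index range, so the factors can be chosen as total functions
    without side conditions.\<close>
  have "\<exists>W R. unitary_mat m W \<and> R \<in> carrier_mat m n \<and> rect_upper_triangular R \<and> ?S ix = W * R" for ix
    using quat_qr_decomposition[OF S] by metis
  then obtain W R where W: "\<And>ix. unitary_mat m (W ix)"
    and R: "\<And>ix. R ix \<in> carrier_mat m n" "\<And>ix. rect_upper_triangular (R ix)"
    and WR: "\<And>ix. ?S ix = W ix * R ix"
    by metis
  have Wc: "\<And>ix. W ix \<in> carrier_mat m m"
    using W unitary_mat_carrier by blast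
  define U where "U = of_hat_slices m m W"
  define T where "T = of_hat_slices m n R"
  define V where "V = of_hat_slices n n (\<lambda>_. 1\<^sub>m n)"
  have "A = of_hat_slices m n ?S"
    using A S by (intro eq_of_hat_slices) auto
  \<comment> \<open>The appended identity is the transformed slice of the conjugate transpose of
    \<open>V\<close>.\<close>
  also have "\<dots> = of_hat_slices m n (\<lambda>ix. (W ix * R ix) * 1\<^sub>m n)"
    using S R Wc by (simp add: WR right_mult_one_mat[OF mult_carrier_mat[OF Wc R(1)]])
  also have "\<dots> = qt_prod Q (qt_prod Q U T) (conj_transpose Q V)"
    unfolding U_def T_def V_def using R Wc
    by (simp add: qt_prod_of_hat_slices conj_transpose_of_hat_slices mult_carrier_mat[OF Wc R(1)])
  finally have dec: "A = qt_prod Q (qt_prod Q U T) (conj_transpose Q V)" .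
  have tri: "frontal_triangular T"
    unfolding frontal_triangular_def triangular_mat_def T_def
    using R by (auto intro: frontal_slice_upper_triangular)
  have "unitary_tensor Q U" "unitary_tensor Q V"
    unfolding U_def V_def using W unitary_mat_one by (auto intro!: unitary_of_hat_slices)
  with dec tri show ?thesis
    by (intro exI[of _ U] exI[of _ T] exI[of _ V]) (simp add: U_def T_def V_def)
qed

end

section \<open>The decomposition for tensors of order \<open>N\<close>\<close>

theorem theorem3p1:
  fixes N :: nat and I :: "nat \<Rightarrow> nat" and Q :: "nat \<Rightarrow> quat mat" and A :: "quat tensor"
  assumes "N \<ge> 3"
    and "\<forall>k\<in>{1..N}. I k > 0"
    and "\<forall>k\<in>{3..N}. Q k \<in> carrier_mat (I k) (I k) \<and> invertible_mat (Q k)"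
    and "dims A = map I [1..<Suc N]"
  shows "\<exists>U T V.
    dims U = I 1 # I 1 # map I [3..<Suc N] \<and>
    dims T = I 1 # I 2 # map I [3..<Suc N] \<and>
    dims V = I 2 # I 2 # map I [3..<Suc N] \<and>
    unitary_tensor Q U \<and> unitary_tensor Q V \<and> frontal_triangular T \<and>
    A = qt_prod Q (qt_prod Q U T) (conj_transpose Q V)"
proof -
  \<comment> \<open>The list of trailing dimensions has length \<open>N - 2\<close>, so the locale's
    range of modes is 3 to \<open>N\<close>.\<close>
  interpret quat_tensor_transform Q "map I [3..<Suc N]"
  proof
    fix k assume "3 \<le> k" "k \<le> length (map I [3..<Suc N]) + 2"
    then have k: "k \<in> {3..N}" using assms(1) by auto
    have "[3..<Suc N] ! (k - 3) = 3 + (k - 3)" "k - 3 < length [3..<Suc N]"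
      using k by (auto intro!: nth_upt simp del: upt_Suc)
    then have "map I [3..<Suc N] ! (k - 3) = I k"
      using k by (simp del: upt_Suc length_upt)
    then show "Q k \<in> carrier_mat (map I [3..<Suc N] ! (k - 3)) (map I [3..<Suc N] ! (k - 3)) \<and>
        invertible_mat (Q k)"
      using assms(3) k by simp
  qed
  have "[1..<Suc N] = 1 # 2 # [3..<Suc N]"
    using assms(1) upt_conv_Cons[of 1 "Suc N"] upt_conv_Cons[of 2 "Suc N"]
    by (simp add: numeral_2_eq_2 numeral_3_eq_3 del: upt_Suc)
  then have "dims A = I 1 # I 2 # map I [3..<Suc N]"
    using assms(4) by simp
  then show ?thesis
    by (rule qt_triangular_decomposition)
qed

end
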